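(* Let $M_1$ and $M_2$ be $q$-matroids over the ground spaces $E_1$ and $E_2$, with sets of cyclic flats $\mathcal{Z}_1$ and $\mathcal{Z}_2$ respectively. Let $$\mathcal{Z}:=\{Z\oplus\mathbf{0}: Z\in\mathcal{Z}_1\setminus\{E_1\}\}\cup\{E_1\oplus Z: Z\in\mathcal{Z}_2\setminus\{\mathbf{0}\}\}\subseteq\mathcal{L}(E_1\oplus E_2).$$ Then the set $\mathcal{Z}(M_1\square M_2)$ of cyclic flats of the free product $M_1\square M_2$ is $$\mathcal{Z}(M_1\square M_2)=\begin{cases}\mathcal{Z}\cup\{E_1\oplus\mathbf{0}\} & \text{if } M_1 \text{ has no coloops and } M_2\text{ has no loops},\\ \mathcal{Z} & \text{otherwise.}\end{cases}$$
   Context: Let $\mathbb{F}_q$ be the finite field with $q$ elements; for a finite-dimensional $\mathbb{F}_q$-space $E$, $\mathcal{L}(E)$ is its subspace lattice and $\mathbf{0}$ is the zero space. A $q$-matroid $M=(E,r)$ is given by $r:\mathcal{L}(E)\to\mathbb{Z}$ with (R1) $0\le r(A)\le\dim(A)$; (R2) $A\le B\Rightarrow r(A)\le r(B)$; (R3) $r(A+B)+r(A\cap B)\le r(A)+r(B)$. A subspace $A$ is independent if $r(A)=\dim A$, dependent otherwise; a circuit is an inclusion-minimal dependent space; a space is cyclic if it is a (possibly empty) sum of circuits; $A$ is a flat if it is inclusion-maximal among the subspaces of rank $r(A)$; a cyclic flat is a space that is both cyclic and a flat. A loop is a one-dimensional space of rank $0$; a coloop is a codimension-1 subspace of $E$ of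 rank less than $r(E)$. Free product: for $q$-matroids $M_i=(E_i,r_i)$, with projections $\pi_i:E_1\oplus E_2\to E_i$ and embeddings $\iota_i:E_i\to E_1\oplus E_2$, put $\lambda_1(A)=r_1(E_1)-r_1(A)$ and $\nu_2(B)=\dim(B)-r_2(B)$. $M_1\square M_2$ is the $q$-matroid on $E_1\oplus E_2$ whose independent spaces are exactly the $I\le E_1\oplus E_2$ with $\pi_1(I\cap\iota_1(E_1))$ independent in $M_1$ and $\lambda_1(\pi_1(I\cap\iota_1(E_1)))\ge\nu_2(\pi_2(I))$. *)

theory Defs
  imports "HOL-Analysis.Product_Vector" "HOL-Library.FuncSet"
begin

text \<open>
  The ground space of a \<open>q\<close>-matroid is the whole type \<open>'e\<close>, a finite-dimensional vector space over
  the finite field \<open>'f\<close> with scalar multiplication \<open>scale\<close>.  Its subspace lattice consists of the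
  sets satisfying \<open>subspace\<close>; the values of \<open>r\<close> on other sets are irrelevant.
\<close>

locale q_matroid = vector_space scale
  for scale :: "'f::{field,finite} \<Rightarrow> 'e::ab_group_add \<Rightarrow> 'e" +
  fixes r :: "'e set \<Rightarrow> int"
  assumes finite_dimensional: "\<exists>B. finite B \<and> span B = UNIV"
    and R1: "subspace A \<Longrightarrow> 0 \<le> r A \<and> r A \<le> int (dim A)"
    and R2: "subspace A \<Longrightarrow> subspace B \<Longrightarrow> A \<subseteq> B \<Longrightarrow> r A \<le> r B"
    and R3: "subspace A \<Longrightarrow> subspace B \<Longrightarrow>
      r {x + y | x y. x \<in> A \<and> y \<in> B} + r (A \<inter> B) \<le> r A + r B"
begin

definition indep_space :: "'e set \<Rightarrow> bool" where
  "indep_space A \<longleftrightarrow> subspace A \<and> r A = int (dim A)"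

definition dep_space :: "'e set \<Rightarrow> bool" where
  "dep_space A \<longleftrightarrow> subspace A \<and> r A \<noteq> int (dim A)"

definition circuit :: "'e set \<Rightarrow> bool" where
  "circuit C \<longleftrightarrow> dep_space C \<and> (\<forall>D. dep_space D \<longrightarrow> D \<subseteq> C \<longrightarrow> D = C)"

text \<open>The sum of a family of subspaces is the span of its union; the empty sum is \<open>{0}\<close>.\<close>

definition cyclic :: "'e set \<Rightarrow> bool" where
  "cyclic A \<longleftrightarrow> (\<exists>\<C>. \<C> \<subseteq> {C. circuit C} \<and> A = span (\<Union>\<C>))"

definition flat :: "'e set \<Rightarrow> bool" where
  "flat A \<longleftrightarrow> subspace A \<and> (\<forall>B. subspace B \<longrightarrow> r B = r A \<longrightarrow> A \<subseteq> B \<longrightarrow> B = A)"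

definition cyclic_flats :: "'e set set" where
  "cyclic_flats = {Z. cyclic Z \<and> flat Z}"

definition loop :: "'e set \<Rightarrow> bool" where
  "loop A \<longleftrightarrow> subspace A \<and> dim A = 1 \<and> r A = 0"

definition coloop :: "'e set \<Rightarrow> bool" where
  "coloop A \<longleftrightarrow> subspace A \<and> dim A + 1 = dim (UNIV :: 'e set) \<and> r A < r UNIV"

definition rank_deficit :: "'e set \<Rightarrow> int" where
  "rank_deficit A = r UNIV - r A"

definition nullity :: "'e set \<Rightarrow> int" where
  "nullity A = int (dim A) - r A"

end

text \<open>The direct sum of the ground spaces is the product type with \<open>module_prod.scale\<close>.\<close>

definition free_product_indep ::
  "('f::{field,finite} \<Rightarrow> 'a::ab_group_add \<Rightarrow> 'a) \<Rightarrow> ('a set \<Rightarrow> int) \<Rightarrow>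
   ('f \<Rightarrow> 'b::ab_group_add \<Rightarrow> 'b) \<Rightarrow> ('b set \<Rightarrow> int) \<Rightarrow> ('a \<times> 'b) set \<Rightarrow> bool" where
  "free_product_indep scale1 r1 scale2 r2 I \<longleftrightarrow>
     module.subspace (module_prod.scale scale1 scale2) I \<and>
     q_matroid.indep_space scale1 r1 (fst ` (I \<inter> range (\<lambda>x. (x, 0)))) \<and>
     q_matroid.rank_deficit r1 (fst ` (I \<inter> range (\<lambda>x. (x, 0))))
       \<ge> q_matroid.nullity scale2 r2 (snd ` I)"

text \<open>
  The rank function of the \<open>q\<close>-matroid whose independent spaces are given by
  \<open>free_product_indep\<close>.  It is determined on subspaces only, hence extensionality.
\<close>

definition free_product ::
  "('f::{field,finite} \<Rightarrow> 'a::ab_group_add \<Rightarrow> 'a) \<Rightarrow> ('a set \<Rightarrow> int) \<Rightarrow>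
   ('f \<Rightarrow> 'b::ab_group_add \<Rightarrow> 'b) \<Rightarrow> ('b set \<Rightarrow> int) \<Rightarrow> ('a \<times> 'b) set \<Rightarrow> int" where
  "free_product scale1 r1 scale2 r2 =
     (THE r. r \<in> extensional {A. module.subspace (module_prod.scale scale1 scale2) A} \<and>
             q_matroid (module_prod.scale scale1 scale2) r \<and>
             (\<forall>I. q_matroid.indep_space (module_prod.scale scale1 scale2) r I \<longleftrightarrow>
                  free_product_indep scale1 r1 scale2 r2 I))"

text \<open>
  The description in the definition of \<open>free_product\<close> is proper: such a \<open>q\<close>-matroid exists, with
  rank function \<open>A \<mapsto> min (r1 UNIV + r2 A2) (r1 A1 + dim A2)\<close> where \<open>A1 = fst ` (A \<inter> range (\<lambda>x. (x, 0)))\<close> and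
  \<open>A2 = snd ` A\<close>, and its independent spaces determine it.
\<close>

lemma (in finite_dimensional_vector_space) subspace_complement:
  assumes "subspace A" "subspace B" "A \<subseteq> B"
  obtains C where "subspace C" "C \<subseteq> B" "{x + y | x y. x \<in> A \<and> y \<in> C} = B"
    "A \<inter> C = {0}" "dim B = dim A + dim C"
proof -
  obtain a where a: "a \<subseteq> A" "independent a" "A \<subseteq> span a" "card a = dim A"
    using basis_exists by blast
  obtain b where b: "a \<subseteq> b" "b \<subseteq> B" "independent b" "B \<subseteq> span b"
    using maximal_independent_subset_extend[of a B] a assms by (metis order_trans)
  have sA: "span a = A" using a assms by (simp add: span_subspace)
  have sB: "span b = B" using b assms by (simp add: span_subspace)
  define C where "C = span (b - a)"
  have sum: "{x + y | x y. x \<in> A \<and> y \<in> C} = B"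
    using span_Un[of a "b - a"] b(1) by (simp add: sA sB C_def Un_absorb1)
  have fb: "finite b" using b(3) finiteI_independent by blast
  have ind: "independent (b - a)" using b(3) independent_mono by blast
  have dC: "dim C = card (b - a)" unfolding C_def using ind by (rule dim_span_eq_card_independent)
  have dB: "dim B = card b" using dim_span_eq_card_independent[OF b(3)] sB by simp
  have dd: "dim B = dim A + dim C"
    using dC dB a(4) b(1) fb by (metis card_Diff_subset card_mono finite_subset le_add_diff_inverse)
  have "dim (A \<inter> C) = 0"
    using dim_sums_Int[of A C] assms(1) sum dd by (simp add: C_def)
  moreover have "0 \<in> A \<inter> C" using assms(1) subspace_0 by (auto simp: C_def)
  ultimately have "A \<inter> C = {0}" by auto
  moreover have "C \<subseteq> B" unfolding C_def sB[symmetric] by (rule span_mono) auto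
  ultimately show ?thesis using that[of C] sum dd by (auto simp: C_def)
qed

lemma (in vector_space) finite_basis:
  assumes "\<exists>B. finite B \<and> span B = UNIV"
  obtains B where "finite_dimensional_vector_space scale B"
proof -
  obtain S where S: "finite S" "span S = UNIV" using assms by blast
  obtain B where B: "B \<subseteq> S" "independent B" "S \<subseteq> span B"
    using maximal_independent_subset by blast
  have "span B = UNIV" using S B by (metis span_mono span_span top.extremum_uniqueI)
  then have "finite_dimensional_vector_space scale B"
    using B S by unfold_locales (auto intro: finite_subset)
  then show ?thesis using that by blast
qed

context q_matroid begin

lemma obtain_basis: obtains B where "finite_dimensional_vector_space scale B"
  using finite_basis[OF finite_dimensional] .

lemma nullity_mono:
  assumes "subspace A" "subspace B" "A \<subseteq> B"
  shows "nullity A \<le> nullity B"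
proof -
  obtain Ba where "finite_dimensional_vector_space scale Ba" by (rule obtain_basis)
  then interpret finite_dimensional_vector_space scale Ba .
  obtain C where C: "subspace C" "{x + y | x y. x \<in> A \<and> y \<in> C} = B"
    "A \<inter> C = {0}" "dim B = dim A + dim C"
    by (rule subspace_complement[OF assms])
  have "r B + r {0} \<le> r A + r C" using R3[OF assms(1) C(1)] unfolding C(2,3) .
  moreover have "0 \<le> r {0}" using R1[OF subspace_single_0] by simp
  moreover have "r C \<le> int (dim C)" using R1[OF C(1)] by simp
  ultimately show ?thesis using C(4) by (simp add: nullity_def)
qed

lemma indep_of_rank:
  assumes A: "subspace A"
  obtains I where "indep_space I" "I \<subseteq> A" "r I = r A"
proof -
  obtain Ba where "finite_dimensional_vector_space scale Ba" by (rule obtain_basis)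
  then interpret finite_dimensional_vector_space scale Ba .
  have "indep_space {0}" unfolding indep_space_def using R1[of "{0}"] by simp
  then have ex: "indep_space {0} \<and> {0} \<subseteq> A" using A subspace_0 by auto
  have bd: "\<forall>I. indep_space I \<and> I \<subseteq> A \<longrightarrow> dim I < Suc dimension"
    by (simp add: dim_subset_UNIV less_Suc_eq_le)
  obtain I where I: "indep_space I" "I \<subseteq> A" and
    Imax: "\<And>I'. indep_space I' \<Longrightarrow> I' \<subseteq> A \<Longrightarrow> dim I' \<le> dim I"
    using ex_has_greatest_nat[of "\<lambda>I. indep_space I \<and> I \<subseteq> A" _ dim, OF ex bd] by blast
  have sI: "subspace I" and rI: "r I = int (dim I)" using I by (auto simp: indep_space_def)
  define P where "P J \<longleftrightarrow> I \<subseteq> J \<and> J \<subseteq> A \<and> r J = r I \<and> subspace J" for J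
  have "P I" using I sI by (simp add: P_def)
  moreover have "\<forall>J. P J \<longrightarrow> dim J < Suc dimension"
    by (simp add: dim_subset_UNIV less_Suc_eq_le)
  ultimately obtain J where PJ: "P J" and PJmax: "\<And>J'. P J' \<Longrightarrow> dim J' \<le> dim J"
    using ex_has_greatest_nat[of P I dim] by blast
  have J: "I \<subseteq> J" "J \<subseteq> A" "r J = r I" "subspace J" using PJ by (auto simp: P_def)
  have Jmax: "dim J' \<le> dim J" if "I \<subseteq> J'" "J' \<subseteq> A" "r J' = r I" "subspace J'" for J'
    using PJmax that by (simp add: P_def)
  have "J = A"
  proof (rule ccontr)
    assume "J \<noteq> A"
    then obtain x where x: "x \<in> A" "x \<notin> J" using J by blast
    define K where "K = span (insert x I)"
    define L where "L = span (insert x J)"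
    have "insert x I \<subseteq> A" "insert x J \<subseteq> A" using x I J by auto
    then have KL: "K \<subseteq> A" "L \<subseteq> A" unfolding K_def L_def using A span_minimal by blast+
    have IJ: "insert x I \<subseteq> K" "insert x J \<subseteq> L" unfolding K_def L_def by (rule span_superset)+
    have sKL: "subspace K" "subspace L" unfolding K_def L_def by (rule subspace_span)+
    note sub = KL IJ sKL
    have spI: "span I = I" and spJ: "span J = J" using sI J(4) by (simp_all add: span_eq_iff)
    have "x \<notin> I" using x J by blast
    then have dI: "dim K = Suc (dim I)"  "dim L = Suc (dim J)"
      using x by (simp_all add: K_def L_def dim_insert spI spJ)
    have rK: "r K = r I"
    proof (rule ccontr)
      assume ne: "r K \<noteq> r I"
      have "r I \<le> r K" using R2[OF sI sKL(1)] IJ by simp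
      moreover have "r K \<le> int (dim K)" using R1 sKL(1) by simp
      ultimately have "r K = int (dim K)" using dI ne rI by auto
      then show False using Imax[of K] sub dI by (auto simp: indep_space_def)
    qed
    have L: "L = {a + b | a b. a \<in> J \<and> b \<in> K}"
    proof -
      have "L = span (J \<union> insert x I)" unfolding L_def using J(1) by (simp add: Un_absorb2)
      also have "\<dots> = {a + b | a b. a \<in> span J \<and> b \<in> span (insert x I)}" by (rule span_Un)
      finally show ?thesis by (simp add: K_def spJ)
    qed
    have "r L + r (J \<inter> K) \<le> r J + r K" unfolding L by (rule R3[OF J(4) sKL(1)])
    moreover have "r I \<le> r (J \<inter> K)" using R2[OF sI, of "J \<inter> K"] J sub by (auto intro: subspace_inter)
    moreover have "r J \<le> r L" using R2[OF J(4) sKL(2)] IJ by simp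
    ultimately have "r L = r I" using rK J by simp
    then show False using Jmax[OF _ KL(2) _ sKL(2)] IJ J(1) dI by auto
  qed
  then show ?thesis using that I J(3) by simp
qed

end

lemma q_matroid_eqI:
  fixes sc :: "'f::{field,finite} \<Rightarrow> 'e::ab_group_add \<Rightarrow> 'e"
  assumes "q_matroid sc r" "q_matroid sc r'"
    and eq: "\<And>I. q_matroid.indep_space sc r I \<longleftrightarrow> q_matroid.indep_space sc r' I"
    and A: "module.subspace sc A"
  shows "r A = r' A"
proof -
  interpret M: q_matroid sc r by fact
  interpret M': q_matroid sc r' by fact
  obtain I where I: "M.indep_space I" "I \<subseteq> A" "r I = r A" using M.indep_of_rank A by metis
  obtain J where J: "M'.indep_space J" "J \<subseteq> A" "r' J = r' A" using M'.indep_of_rank A by metis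
  have "r A \<le> r' A" using I eq[of I] M'.R2[of I A] A by (auto simp: M.indep_space_def M'.indep_space_def)
  moreover have "r' A \<le> r A" using J eq[of J] M.R2[of J A] A by (auto simp: M.indep_space_def M'.indep_space_def)
  ultimately show ?thesis by simp
qed

theorem free_product_well_defined:
  fixes scale1 :: "'f::{field,finite} \<Rightarrow> 'a::ab_group_add \<Rightarrow> 'a" and r1 :: "'a set \<Rightarrow> int"
    and scale2 :: "'f \<Rightarrow> 'b::ab_group_add \<Rightarrow> 'b" and r2 :: "'b set \<Rightarrow> int"
  assumes "q_matroid scale1 r1" "q_matroid scale2 r2"
  shows "\<exists>!r. r \<in> extensional {A. module.subspace (module_prod.scale scale1 scale2) A} \<and>
             q_matroid (module_prod.scale scale1 scale2) r \<and>
             (\<forall>I. q_matroid.indep_space (module_prod.scale scale1 scale2) r I \<longleftrightarrow>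
                  free_product_indep scale1 r1 scale2 r2 I)"
proof -
  interpret M1: q_matroid scale1 r1 by fact
  interpret M2: q_matroid scale2 r2 by fact
  obtain B1 where "finite_dimensional_vector_space scale1 B1" by (rule M1.obtain_basis)
  then interpret F1: finite_dimensional_vector_space scale1 B1 .
  obtain B2 where "finite_dimensional_vector_space scale2 B2" by (rule M2.obtain_basis)
  then interpret F2: finite_dimensional_vector_space scale2 B2 .
  interpret P: finite_dimensional_vector_space_prod scale1 scale2 B1 B2 ..
  interpret snd: Vector_Spaces.linear P.scale scale2 snd by (rule P.linear_snd)
  interpret fst: Vector_Spaces.linear P.scale scale1 fst by (rule P.linear_fst)
  interpret PS: finite_dimensional_vector_space_pair P.scale P.Basis_pair scale2 B2 ..
  interpret PF: finite_dimensional_vector_space_pair P.scale P.Basis_pair scale1 B1 ..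
  let ?R = "range (\<lambda>x. (x, 0)) :: ('a \<times> 'b) set"
  define p1 where "p1 A = fst ` (A \<inter> ?R)" for A :: "('a \<times> 'b) set"
  define p2 where "p2 A = snd ` A" for A :: "('a \<times> 'b) set"
  let ?sum = "\<lambda>A B :: ('a \<times> 'b) set. {x + y | x y. x \<in> A \<and> y \<in> B}"
  have R: "P.p.subspace ?R" unfolding P.p.subspace_def by (auto simp: P.scale_def zero_prod_def)
  have s1: "M1.subspace (p1 A)" if "P.p.subspace A" for A
    unfolding p1_def using that R by (intro fst.subspace_image P.p.subspace_inter)
  have s2: "M2.subspace (p2 A)" if "P.p.subspace A" for A
    unfolding p2_def using that by (intro snd.subspace_image)
  have dim: "P.p.dim A = M1.dim (p1 A) + M2.dim (p2 A)" if A: "P.p.subspace A" for A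
  proof -
    have sAR: "P.p.subspace (A \<inter> ?R)" using A R by (rule P.p.subspace_inter)
    obtain C where C: "P.p.subspace C" "C \<subseteq> A" "?sum (A \<inter> ?R) C = A" "(A \<inter> ?R) \<inter> C = {0}"
        "P.p.dim A = P.p.dim (A \<inter> ?R) + P.p.dim C"
      by (rule P.p.subspace_complement[OF sAR A]) auto
    have "snd ` A \<subseteq> snd ` C"
    proof
      fix z assume "z \<in> snd ` A"
      then obtain w where "w \<in> A" "z = snd w" by blast
      then obtain x y where "x \<in> A \<inter> ?R" "y \<in> C" "w = x + y" using C(3) by blast
      then show "z \<in> snd ` C" using \<open>z = snd w\<close> by auto
    qed
    then have 1: "snd ` A = snd ` C" using C(2) by blast
    have "inj_on snd C"
    proof (rule inj_onI)
      fix x y assume xy: "x \<in> C" "y \<in> C" "snd x = snd y"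
      then have "x - y \<in> C" using C(1) P.p.subspace_diff by blast
      moreover have "x - y \<in> ?R" using xy by (auto simp: image_iff prod_eq_iff)
      ultimately have "x - y = 0" using C by blast
      then show "x = y" by simp
    qed
    then have "M2.dim (snd ` C) = P.p.dim C"
      using PS.dim_image_eq[OF snd.linear_axioms, of C] C(1) P.p.span_eq_iff by metis
    moreover have "inj_on fst (A \<inter> ?R)" by (auto simp: inj_on_def)
    then have "M1.dim (fst ` (A \<inter> ?R)) = P.p.dim (A \<inter> ?R)"
      using PF.dim_image_eq[OF fst.linear_axioms, of "A \<inter> ?R"] sAR P.p.span_eq_iff by metis
    ultimately show ?thesis using C(5) 1 by (simp add: p1_def p2_def)
  qed
  have p1_eq: "p1 A = {x. (x, 0) \<in> A}" for A by (force simp: p1_def)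
  have p1m: "p1 A \<subseteq> p1 B" "p2 A \<subseteq> p2 B" if "A \<subseteq> B" for A B using that by (auto simp: p1_def p2_def)
  have p1i: "p1 (A \<inter> B) = p1 A \<inter> p1 B" for A B by (auto simp: p1_eq)
  have p1sum: "{x + y | x y. x \<in> p1 A \<and> y \<in> p1 B} \<subseteq> p1 (?sum A B)" for A B
  proof
    fix z assume "z \<in> {x + y | x y. x \<in> p1 A \<and> y \<in> p1 B}"
    then obtain x y where "z = x + y" "(x, 0) \<in> A" "(y, 0) \<in> B" by (auto simp: p1_eq)
    moreover from this have "(z, 0 :: 'b) = (x, 0) + (y, 0)" by simp
    ultimately show "z \<in> p1 (?sum A B)" unfolding p1_eq by blast
  qed
  have p2sum: "p2 (?sum A B) = {x + y | x y. x \<in> p2 A \<and> y \<in> p2 B}" for A B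
  proof (intro equalityI subsetI)
    fix z assume "z \<in> p2 (?sum A B)"
    then obtain x y where "x \<in> A" "y \<in> B" "z = snd x + snd y" unfolding p2_def by auto
    then show "z \<in> {x + y | x y. x \<in> p2 A \<and> y \<in> p2 B}" unfolding p2_def by blast
  next
    fix z assume "z \<in> {x + y | x y. x \<in> p2 A \<and> y \<in> p2 B}"
    then obtain x y where "x \<in> A" "y \<in> B" "z = snd (x + y)" unfolding p2_def by auto
    then show "z \<in> p2 (?sum A B)" unfolding p2_def by blast
  qed
  define f where "f A = r1 UNIV + r2 (p2 A)" for A
  define g where "g A = r1 (p1 A) + int (M2.dim (p2 A))" for A
  define r where "r A = min (f A) (g A)" for A
  have qm: "q_matroid P.scale r"
  proof unfold_locales
    show "\<exists>B. finite B \<and> P.p.span B = UNIV"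
      using P.p.finite_Basis P.p.span_Basis by blast
  next
    fix A assume A: "P.p.subspace A"
    have "0 \<le> r1 UNIV" "0 \<le> r2 (p2 A)" "0 \<le> r1 (p1 A)" "r1 (p1 A) \<le> int (M1.dim (p1 A))"
      using M1.R1 M2.R1 s1[OF A] s2[OF A] by auto
    then show "0 \<le> r A \<and> r A \<le> int (P.p.dim A)"
      by (auto simp: r_def f_def g_def dim[OF A])
  next
    fix A B assume AB: "P.p.subspace A" "P.p.subspace B" "A \<subseteq> B"
    have "r2 (p2 A) \<le> r2 (p2 B)" "r1 (p1 A) \<le> r1 (p1 B)" "M2.dim (p2 A) \<le> M2.dim (p2 B)"
      using M1.R2[OF s1[OF AB(1)] s1[OF AB(2)] p1m(1)[OF AB(3)]]
        M2.R2[OF s2[OF AB(1)] s2[OF AB(2)] p1m(2)[OF AB(3)]] F2.dim_subset[OF p1m(2)[OF AB(3)]] by simp_all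
    then show "r A \<le> r B" by (auto simp: r_def f_def g_def)
  next
    fix A B assume AB: "P.p.subspace A" "P.p.subspace B"
    have mixed: "f (?sum A B) + g (A \<inter> B) \<le> f A + g B \<and>
       f (?sum A B) + f (A \<inter> B) \<le> f A + f B \<and> g (?sum A B) + g (A \<inter> B) \<le> g A + g B"
      if AB: "P.p.subspace A" "P.p.subspace B" for A B
    proof -
      have S: "P.p.subspace (?sum A B)" and I: "P.p.subspace (A \<inter> B)"
        by (rule P.p.subspace_sums[OF AB], rule P.p.subspace_inter[OF AB])
      note ss = s1[OF AB(1)] s1[OF AB(2)] s2[OF AB(1)] s2[OF AB(2)] s1[OF S] s2[OF S] s1[OF I] s2[OF I]
      have i2: "p2 (A \<inter> B) \<subseteq> p2 A \<inter> p2 B" by (auto simp: p2_def)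
      have si2: "M2.subspace (p2 A \<inter> p2 B)" using ss by (intro M2.subspace_inter)
      have a: "r2 (p2 (?sum A B)) + r2 (p2 A \<inter> p2 B) \<le> r2 (p2 A) + r2 (p2 B)"
        unfolding p2sum by (rule M2.R3[OF ss(3,4)])
      have b: "r2 (p2 (A \<inter> B)) \<le> r2 (p2 A \<inter> p2 B)" by (rule M2.R2[OF ss(8) si2 i2])
      have c: "M2.nullity (p2 A \<inter> p2 B) \<le> M2.nullity (p2 B)" by (rule M2.nullity_mono[OF si2 ss(4)]) simp
      have d: "int (M2.dim (p2 (A \<inter> B))) \<le> int (M2.dim (p2 A \<inter> p2 B))" using F2.dim_subset[OF i2] by simp
      have e: "r1 (p1 (A \<inter> B)) \<le> r1 (p1 B)" by (rule M1.R2[OF ss(7,2) p1m(1)]) simp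
      define S1 where "S1 = {x + y | x y. x \<in> p1 A \<and> y \<in> p1 B}"
      have sS1: "M1.subspace S1" unfolding S1_def by (rule M1.subspace_sums[OF ss(1,2)])
      have h: "r1 S1 + r1 (p1 (A \<inter> B)) \<le> r1 (p1 A) + r1 (p1 B)"
        unfolding S1_def p1i by (rule M1.R3[OF ss(1,2)])
      have j: "M1.nullity S1 \<le> M1.nullity (p1 (?sum A B))"
        by (rule M1.nullity_mono[OF sS1 ss(5)]) (unfold S1_def, rule p1sum)
      have k: "M1.dim S1 + M1.dim (p1 (A \<inter> B)) = M1.dim (p1 A) + M1.dim (p1 B)"
        unfolding S1_def p1i by (rule F1.dim_sums_Int[OF ss(1,2)])
      have l: "P.p.dim (?sum A B) + P.p.dim (A \<inter> B) = P.p.dim A + P.p.dim B"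
        by (rule P.p.dim_sums_Int[OF AB])
      have 1: "f (?sum A B) + g (A \<inter> B) \<le> f A + g B"
        using a c d e unfolding f_def g_def M2.nullity_def by linarith
      have 2: "f (?sum A B) + f (A \<inter> B) \<le> f A + f B"
        using a b unfolding f_def by linarith
      have "M2.dim (p2 (?sum A B)) + M2.dim (p2 (A \<inter> B)) + (M1.dim (p1 (?sum A B)) + M1.dim (p1 (A \<inter> B)))
          = M2.dim (p2 A) + M2.dim (p2 B) + (M1.dim (p1 A) + M1.dim (p1 B))"
        using l unfolding dim[OF S] dim[OF I] dim[OF AB(1)] dim[OF AB(2)] by linarith
      then have 3: "g (?sum A B) + g (A \<inter> B) \<le> g A + g B"
        using h j k unfolding g_def M1.nullity_def by linarith
      show ?thesis using 1 2 3 by blast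
    qed
    have c: "?sum B A = ?sum A B" using add.commute by blast
    show "r (?sum A B) + r (A \<inter> B) \<le> r A + r B"
      using mixed[OF AB] mixed[OF AB(2,1)] unfolding c Int_commute[of B A] r_def by linarith
  qed
  then interpret Q: q_matroid P.scale r .
  have ind: "Q.indep_space I \<longleftrightarrow> free_product_indep scale1 r1 scale2 r2 I" for I
  proof (cases "P.p.subspace I")
    case True
    have "r1 (p1 I) \<le> int (M1.dim (p1 I))" "r2 (p2 I) \<le> int (M2.dim (p2 I))"
      using M1.R1 M2.R1 s1[OF True] s2[OF True] by auto
    then show ?thesis using True s1[OF True] dim[OF True]
      unfolding Q.indep_space_def free_product_indep_def M1.indep_space_def
        M1.rank_deficit_def M2.nullity_def p1_def[symmetric] p2_def[symmetric] r_def f_def g_def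
      by auto
  qed (auto simp: Q.indep_space_def free_product_indep_def)
  define r' where "r' = restrict r {A. P.p.subspace A}"
  have r': "r' A = r A" if "P.p.subspace A" for A using that by (simp add: r'_def)
  have qm': "q_matroid P.scale r'"
    apply unfold_locales
    subgoal by (rule Q.finite_dimensional)
    subgoal using Q.R1 by (simp only: r')
    subgoal using Q.R2 by (simp only: r')
    subgoal using Q.R3 by (simp only: r' P.p.subspace_sums P.p.subspace_inter)
    done
  then interpret Q': q_matroid P.scale r' .
  have ind': "Q'.indep_space I \<longleftrightarrow> free_product_indep scale1 r1 scale2 r2 I" for I
    using ind[of I] by (auto simp: Q.indep_space_def Q'.indep_space_def r')
  show ?thesis
  proof (rule ex1I[of _ r'])
    show "r' \<in> extensional {A. P.p.subspace A} \<and> q_matroid P.scale r' \<and>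
      (\<forall>I. q_matroid.indep_space P.scale r' I \<longleftrightarrow> free_product_indep scale1 r1 scale2 r2 I)"
      using qm' ind' by (simp add: r'_def)
  next
    fix s assume s: "s \<in> extensional {A. P.p.subspace A} \<and> q_matroid P.scale s \<and>
      (\<forall>I. q_matroid.indep_space P.scale s I \<longleftrightarrow> free_product_indep scale1 r1 scale2 r2 I)"
    show "s = r'"
    proof (rule extensionalityI)
      show "s \<in> extensional {A. P.p.subspace A}" using s by blast
      show "r' \<in> extensional {A. P.p.subspace A}" by (simp add: r'_def)
      fix A assume "A \<in> {A. P.p.subspace A}"
      then have A: "P.p.subspace A" by simp
      have "q_matroid P.scale s" using s by (elim conjE)
      moreover have "q_matroid.indep_space P.scale s I \<longleftrightarrow> Q'.indep_space I" for I
        using s ind'[of I] by simp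
      ultimately show "s A = r' A" using qm' A by (intro q_matroid_eqI)
    qed
  qed
qed

end

theory Submission
  imports Defs
begin

text \<open>
  The cyclic spaces are the subspaces all of whose hyperplanes have full rank, so being a cyclic
  flat can be read off the rank function.  Write \<open>A1 = {x. (x, 0) \<in> A}\<close> and \<open>A2 = snd ` A\<close>.  The free
  product has rank \<open>min (r1 UNIV + r2 A2) (r1 A1 + dim A2)\<close>.  If the minimum is the first term,
  adding \<open>UNIV \<times> {0}\<close> does not change the rank, so a flat contains it; if it is the second term and
  \<open>A2 \<noteq> {0}\<close>, passing to a hyperplane of \<open>A2\<close> decreases the rank, so \<open>A\<close> is not cyclic.
  Hence a cyclic flat has the form \<open>X \<times> {0}\<close> or \<open>UNIV \<times> Y\<close>.
\<close>

section \<open>Circuits, cyclic spaces, loops and coloops in a single q-matroid\<close>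

locale finite_dimensional_q_matroid =
  q_matroid scale r + finite_dimensional_vector_space scale Basis
  for scale :: "'f::{field,finite} \<Rightarrow> 'e::ab_group_add \<Rightarrow> 'e" and r and Basis
begin

lemma span_of_subspace: "subspace A \<Longrightarrow> span A = A"
  by (simp add: span_eq_iff)

lemma dim_strict_mono:
  assumes "subspace A" "subspace B" "A \<subset> B"
  shows "dim A < dim B"
  using dim_psubset[of A B] assms by (simp add: span_of_subspace)

text \<open>Starting from \<open>W\<close>, one vector of \<open>A\<close> is added at a time. The
  lower bound \<open>W\<close> matters in \<open>rank_eq\<close>, where a space of prescribed
  dimension has to contain a given independent space.\<close>

lemma obtain_subspace_of_dim:
  assumes "subspace A" "subspace W" "W \<subseteq> A" "dim W \<le> n" "n \<le> dim A"
  obtains H where "subspace H" "W \<subseteq> H" "H \<subseteq> A" "dim H = n"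
proof -
  have "\<exists>H. subspace H \<and> W \<subseteq> H \<and> H \<subseteq> A \<and> dim H = n"
    using assms(4,5)
  proof (induction n rule: dec_induct)
    case base
    then show ?case using assms by blast
  next
    case (step n)
    then obtain H where H: "subspace H" "W \<subseteq> H" "H \<subseteq> A" "dim H = n" by auto
    with step.prems have "H \<noteq> A" by auto
    then obtain x where x: "x \<in> A" "x \<notin> H" using H by blast
    have sp: "span H = H" using H by (simp add: span_of_subspace)
    have "span (insert x H) \<subseteq> A" using x H assms(1) by (intro span_minimal) auto
    moreover have "insert x H \<subseteq> span (insert x H)" by (rule span_superset)
    moreover have "dim (span (insert x H)) = Suc n" using x H(4) by (simp add: dim_insert sp)
    ultimately show ?case using H by (intro exI[of _ "span (insert x H)"]) auto
  qed
  then show ?thesis using that by blast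
qed

lemma obtain_hyperplane:
  assumes "subspace A" "subspace W" "W \<subset> A"
  obtains H where "subspace H" "W \<subseteq> H" "H \<subseteq> A" "dim H + 1 = dim A"
proof -
  have "dim W < dim A"
    using assms by (intro dim_strict_mono)
  then have n: "dim W \<le> dim A - 1" "dim A - 1 \<le> dim A" "dim A - 1 + 1 = dim A" by auto
  have "W \<subseteq> A" using assms(3) by blast
  then show ?thesis
    using obtain_subspace_of_dim[OF assms(1,2) _ n(1,2)] n(3) that by metis
qed

lemma rank_zero_space [simp]: "r {0} = 0"
  using R1[OF subspace_single_0] by simp

text \<open>A dependent subspace of \<open>A\<close> of least dimension is
  inclusion-minimal.\<close>

lemma exists_circuit_subset:
  assumes "dep_space A"
  obtains C where "circuit C" "C \<subseteq> A"
proof -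
  obtain C where C: "dep_space C \<and> C \<subseteq> A"
    and min: "\<And>D. dep_space D \<and> D \<subseteq> A \<Longrightarrow> dim C \<le> dim D"
    using assms ex_has_least_nat[of "\<lambda>D. dep_space D \<and> D \<subseteq> A" A dim] by blast
  have "circuit C"
    unfolding circuit_def
  proof (intro conjI allI impI)
    fix D assume D: "dep_space D" "D \<subseteq> C"
    then have "dim C \<le> dim D" using C by (intro min) auto
    with C D show "D = C" by (intro subspace_dim_equal) (auto simp: dep_space_def)
  qed (use C in blast)
  then show ?thesis using that C by blast
qed

lemma subspace_circuit: "circuit C \<Longrightarrow> subspace C"
  by (simp add: circuit_def dep_space_def)

lemma psubset_circuit_indep: "circuit C \<Longrightarrow> subspace D \<Longrightarrow> D \<subset> C \<Longrightarrow> r D = int (dim D)"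
  by (auto simp: circuit_def dep_space_def)

lemma subspace_cyclic: "cyclic A \<Longrightarrow> subspace A"
  by (auto simp: cyclic_def)

lemma subspace_cyclic_flats: "Z \<in> cyclic_flats \<Longrightarrow> subspace Z"
  by (auto simp: cyclic_flats_def flat_def)

text \<open>Some circuit \<open>C\<close> among the generators of \<open>A\<close> is not contained
  in \<open>H\<close>, so \<open>H\<close> and \<open>C\<close> together span \<open>A\<close>.
  Submodularity for this pair gives the missing inequality \<open>r A \<le> r H\<close>.\<close>

lemma rank_hyperplane_cyclic:
  assumes "cyclic A" and H: "subspace H" "H \<subseteq> A" "dim H + 1 = dim A"
  shows "r H = r A"
proof -
  have A: "subspace A" by (rule subspace_cyclic[OF assms(1)])
  obtain \<C> where \<C>: "\<C> \<subseteq> {C. circuit C}" "A = span (\<Union>\<C>)"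
    using assms(1) by (auto simp: cyclic_def)
  have "\<not> \<Union>\<C> \<subseteq> H"
  proof
    assume "\<Union>\<C> \<subseteq> H"
    then have "A \<subseteq> H" using \<C>(2) H(1) by (simp add: span_minimal)
    then show False using H by auto
  qed
  then obtain C where C: "C \<in> \<C>" "\<not> C \<subseteq> H" by blast
  have circ: "circuit C" and sC: "subspace C" using C \<C> subspace_circuit by blast+
  have CA: "C \<subseteq> A" using C \<C> span_superset by blast
  define S where "S = {x + y | x y. x \<in> H \<and> y \<in> C}"
  have sS: "subspace S" unfolding S_def by (rule subspace_sums[OF H(1) sC])
  have HC: "subspace (H \<inter> C)" using H(1) sC by (rule subspace_inter)
  have SA: "S \<subseteq> A" using H CA A subspace_add unfolding S_def by blast
  have "H \<subseteq> S" "C \<subseteq> S"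
    using subspace_0[OF sC] subspace_0[OF H(1)] unfolding S_def by force+
  then have "H \<subset> S" using C by blast
  then have "dim H < dim S" using H sS by (intro dim_strict_mono)
  then have "S = A" using H SA sS A by (intro subspace_dim_equal) auto
  have dims: "dim S + dim (H \<inter> C) = dim H + dim C"
    unfolding S_def by (rule dim_sums_Int[OF H(1) sC])
  have "r S + r (H \<inter> C) \<le> r H + r C" unfolding S_def by (rule R3[OF H(1) sC])
  \<comment> \<open>Since \<open>dim C = dim (H \<inter> C) + 1\<close>, the independence of
    \<open>H \<inter> C\<close> and the dependence of \<open>C\<close> give
    \<open>r C \<le> r (H \<inter> C)\<close>, so these two terms drop out of submodularity.\<close>
  moreover have "r (H \<inter> C) = int (dim (H \<inter> C))"
    using C HC by (intro psubset_circuit_indep[OF circ]) auto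
  moreover have "r C < int (dim C)"
    using R1[OF sC] circ by (auto simp: circuit_def dep_space_def)
  ultimately have "r A \<le> r H" using dims H(3) unfolding \<open>S = A\<close> by linarith
  then show ?thesis using R2[OF H(1) A H(2)] by simp
qed

text \<open>
  Conversely, if the sum of the circuits in \<open>A\<close> is proper, put it into a hyperplane \<open>H\<close>.
  A maximal independent space of \<open>H\<close> extends to one of larger dimension in \<open>A\<close>, since a circuit
  in the extension would already lie in the maximal independent space.
\<close>

lemma cyclic_iff_hyperplanes:
  "cyclic A \<longleftrightarrow> subspace A \<and>
     (\<forall>H. subspace H \<longrightarrow> H \<subseteq> A \<longrightarrow> dim H + 1 = dim A \<longrightarrow> r H = r A)"
  (is "_ \<longleftrightarrow> subspace A \<and> ?full")
proof
  show "cyclic A \<Longrightarrow> subspace A \<and> ?full"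
    using rank_hyperplane_cyclic subspace_cyclic by blast
next
  assume *: "subspace A \<and> ?full"
  then have A: "subspace A" by blast
  define \<C> where "\<C> = {C. circuit C \<and> C \<subseteq> A}"
  define W where "W = span (\<Union>\<C>)"
  have WA: "W \<subseteq> A" unfolding W_def using A by (intro span_minimal) (auto simp: \<C>_def)
  have "W = A"
  proof (rule ccontr)
    assume "W \<noteq> A"
    then have "W \<subset> A" using WA by blast
    then obtain H where H: "subspace H" "W \<subseteq> H" "H \<subseteq> A" "dim H + 1 = dim A"
      using obtain_hyperplane[OF A] by (metis W_def subspace_span)
    then have "H \<noteq> A" by auto
    then obtain x where x: "x \<in> A" "x \<notin> H" using H by blast
    obtain I where I: "indep_space I" "I \<subseteq> H" "r I = r H" using H(1) by (rule indep_of_rank)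
    have sI: "span I = I" "subspace I" using I by (auto simp: indep_space_def span_of_subspace)
    define K where "K = span (insert x I)"
    have KA: "K \<subseteq> A" unfolding K_def using x I H A by (intro span_minimal) auto
    have dK: "dim K = Suc (dim I)" using x I by (auto simp: K_def dim_insert sI(1))
    have KH: "K \<inter> H = I"
    proof
      have sKH: "subspace (K \<inter> H)" using H by (auto simp: K_def intro: subspace_inter)
      have IKH: "I \<subseteq> K \<inter> H" using I span_superset[of "insert x I"] by (auto simp: K_def)
      have "x \<in> K" using span_base[of x "insert x I"] by (simp add: K_def)
      then have "K \<inter> H \<subset> K" using x by blast
      then have "dim (K \<inter> H) < dim K" using sKH by (intro dim_strict_mono) (auto simp: K_def)
      then show "K \<inter> H \<subseteq> I"
        using subspace_dim_equal[OF sI(2) sKH IKH] dK by auto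
    qed (use I span_superset[of "insert x I"] in \<open>auto simp: K_def\<close>)
    have "indep_space K"
    proof (rule ccontr)
      assume "\<not> indep_space K"
      then have "dep_space K" by (auto simp: dep_space_def indep_space_def K_def)
      then obtain C where C: "circuit C" "C \<subseteq> K" by (rule exists_circuit_subset)
      then have "C \<subseteq> W" unfolding W_def using KA span_superset[of "\<Union>\<C>"] \<C>_def by blast
      then have "C \<subseteq> I" using C H KH by blast
      \<comment> \<open>Nullity is monotone, so an independent space contains no circuit.\<close>
      then have "nullity C \<le> nullity I"
        using C sI subspace_circuit by (intro nullity_mono) auto
      then show False using I C R1[OF subspace_circuit[OF C(1)]]
        by (auto simp: nullity_def indep_space_def circuit_def dep_space_def)
    qed
    then have "r K = r H + 1" using dK I by (simp add: indep_space_def)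
    moreover have "r K \<le> r A" using R2[OF _ A KA] by (simp add: K_def)
    moreover have "r H = r A" using * H by blast
    ultimately show False by simp
  qed
  then show "cyclic A" unfolding cyclic_def W_def by (intro exI[of _ \<C>]) (auto simp: \<C>_def)
qed

text \<open>Coloops are exactly the hyperplanes that violate the criterion
  \<open>cyclic_iff_hyperplanes\<close> for the whole space.\<close>

lemma coloop_iff_not_cyclic: "(\<exists>H. coloop H) \<longleftrightarrow> \<not> cyclic UNIV"
proof -
  have "r H \<noteq> r UNIV \<longleftrightarrow> r H < r UNIV" if "subspace H" for H
    using R2[OF that subspace_UNIV] by auto
  then show ?thesis unfolding cyclic_iff_hyperplanes coloop_def by auto
qed

text \<open>By monotonicity every line in a space of rank zero is a loop. This form compares
  directly with flatness of \<open>{0}\<close>.\<close>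

lemma loop_iff_rank_zero: "(\<exists>L. loop L) \<longleftrightarrow> (\<exists>A. subspace A \<and> A \<noteq> {0} \<and> r A = 0)"
proof
  assume "\<exists>L. loop L"
  then show "\<exists>A. subspace A \<and> A \<noteq> {0} \<and> r A = 0"
    by (metis dim_eq_0 loop_def order_refl zero_neq_one)
next
  assume "\<exists>A. subspace A \<and> A \<noteq> {0} \<and> r A = 0"
  then obtain A where A: "subspace A" "A \<noteq> {0}" "r A = 0" by blast
  then have "{0} \<subseteq> A" "1 \<le> dim A" using subspace_0[of A] by (auto simp: Suc_le_eq)
  then obtain L where L: "subspace L" "L \<subseteq> A" "dim L = 1"
    using obtain_subspace_of_dim[OF A(1) subspace_single_0, of 1] by auto
  then have "r L = 0" using R2[of L A] R1[of L] A by auto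
  then show "\<exists>L. loop L" using L by (auto simp: loop_def)
qed

text \<open>A hyperplane of \<open>A\<close> has the same rank as \<open>A\<close>, and that rank is
  at most its dimension, which is \<open>dim A - 1\<close>.\<close>

lemma cyclic_nonzero_nullity:
  assumes "cyclic A" "A \<noteq> {0}"
  shows "r A < int (dim A)"
proof -
  have A: "subspace A" by (rule subspace_cyclic[OF assms(1)])
  then have "{0} \<subset> A" using assms(2) subspace_0 by auto
  then obtain H where H: "subspace H" "H \<subseteq> A" "dim H + 1 = dim A"
    using obtain_hyperplane[OF A subspace_single_0] by metis
  then have "r A = r H" using rank_hyperplane_cyclic[OF assms(1)] by simp
  then show ?thesis using R1[OF H(1)] H(3) by linarith
qed

end


section \<open>The free product: fibre, projection and rank function\<close>

locale q_matroid_pair =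
  M1: finite_dimensional_q_matroid scale1 r1 B1 + M2: finite_dimensional_q_matroid scale2 r2 B2
  for scale1 :: "'f::{field,finite} \<Rightarrow> 'a::ab_group_add \<Rightarrow> 'a" and r1 B1
    and scale2 :: "'f \<Rightarrow> 'b::ab_group_add \<Rightarrow> 'b" and r2 B2
begin

sublocale finite_dimensional_vector_space_prod scale1 scale2 B1 B2 ..

abbreviation rank :: "('a \<times> 'b) set \<Rightarrow> int" where
  "rank \<equiv> free_product scale1 r1 scale2 r2"

lemma free_product_spec:
  "q_matroid scale rank \<and>
   (\<forall>I. q_matroid.indep_space scale rank I \<longleftrightarrow> free_product_indep scale1 r1 scale2 r2 I)"
  unfolding free_product_def
  using theI'[OF free_product_well_defined[OF M1.q_matroid_axioms M2.q_matroid_axioms]] by blast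

sublocale M: finite_dimensional_q_matroid scale rank Basis_pair
  unfolding finite_dimensional_q_matroid_def
  using free_product_spec p.finite_dimensional_vector_space_axioms by blast

text \<open>This is \<pi>1 of the intersection with \<iota>1(E1), in a form without images;
  \<open>indep_space_iff\<close> makes the identification.\<close>

definition fibre :: "('a \<times> 'b) set \<Rightarrow> 'a set" where
  "fibre A = {x. (x, 0) \<in> A}"

lemma fibre_Times: "0 \<in> Y \<Longrightarrow> fibre (X \<times> Y) = X"
  by (auto simp: fibre_def)

lemma snd_Times: "0 \<in> X \<Longrightarrow> snd ` (X \<times> Y) = Y"
  by force

lemma subspace_fibre:
  assumes A: "p.subspace A"
  shows "M1.subspace (fibre A)"
proof (rule M1.subspaceI)
  show "0 \<in> fibre A" using p.subspace_0[OF A] by (simp add: fibre_def zero_prod_def)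
  show "x + y \<in> fibre A" if "x \<in> fibre A" "y \<in> fibre A" for x y
    using that p.subspace_add[OF A, of "(x, 0)" "(y, 0)"] by (simp add: fibre_def)
  show "scale1 c x \<in> fibre A" if "x \<in> fibre A" for c x
    using that p.subspace_scale[OF A, of "(x, 0)" c] by (simp add: fibre_def scale_prod)
qed

lemma subspace_snd: "p.subspace A \<Longrightarrow> M2.subspace (snd ` A)"
proof -
  interpret snd: Vector_Spaces.linear scale scale2 snd by (rule linear_snd)
  show "p.subspace A \<Longrightarrow> M2.subspace (snd ` A)" by (rule snd.subspace_image)
qed

lemma indep_space_iff:
  "M.indep_space I \<longleftrightarrow> p.subspace I \<and> M1.indep_space (fibre I) \<and>
     M2.nullity (snd ` I) \<le> M1.rank_deficit (fibre I)"
proof -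
  have "fst ` (I \<inter> range (\<lambda>x. (x, 0))) = fibre I"
    by (force simp: fibre_def)
  then show ?thesis using free_product_spec by (simp add: free_product_indep_def)
qed

text \<open>The dimension formula for \<open>A\<close> and \<open>UNIV \<times> {0}\<close>.\<close>

lemma dim_eq:
  assumes A: "p.subspace A"
  shows "p.dim A = M1.dim (fibre A) + M2.dim (snd ` A)"
proof -
  let ?E = "UNIV \<times> {0} :: ('a \<times> 'b) set"
  have E: "p.subspace ?E" by (intro subspace_Times) auto
  have 1: "A \<inter> ?E = fibre A \<times> {0}" by (auto simp: fibre_def)
  have 2: "{x + y | x y. x \<in> A \<and> y \<in> ?E} = UNIV \<times> snd ` A"
  proof (intro equalityI subsetI)
    fix z :: "'a \<times> 'b" assume "z \<in> UNIV \<times> snd ` A"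
    then obtain a where a: "a \<in> A" "snd z = snd a" by auto
    then have "z = a + (fst z - fst a, 0)" by (simp add: prod_eq_iff)
    then show "z \<in> {x + y | x y. x \<in> A \<and> y \<in> ?E}" using a by blast
  qed force
  show ?thesis
    using p.dim_sums_Int[OF A E] unfolding 1 2
    using subspace_fibre[OF A] subspace_snd[OF A] by (simp add: dim_Times del: M1.dim_UNIV)
qed

lemma eq_of_parts_eq:
  assumes "p.subspace A" "p.subspace B" "A \<subseteq> B" "fibre A = fibre B" "snd ` A = snd ` B"
  shows "A = B"
  using assms by (intro p.subspace_dim_equal) (simp_all add: dim_eq)

lemma Times_UNIV_of_fibre:
  assumes A: "p.subspace A" and "fibre A = UNIV"
  shows "A = UNIV \<times> snd ` A"
proof -
  have "A \<subseteq> UNIV \<times> snd ` A" by force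
  then show ?thesis
    using assms subspace_snd[OF A] M2.subspace_0[OF subspace_snd[OF A]]
    by (intro eq_of_parts_eq subspace_Times) (simp_all add: fibre_Times snd_Times)
qed

text \<open>Produces subspaces of \<open>A\<close> with prescribed fibre and projection: independent
  spaces in \<open>rank_eq\<close>, hyperplanes in \<open>cyclic_flat_cases\<close>. The part
  \<open>T\<close> of \<open>A\<close> over \<open>D\<close> contains
  \<open>fibre A \<times> {0}\<close>; a complement of the latter in \<open>T\<close> still projects
  onto \<open>D\<close>, and adding \<open>J \<times> {0}\<close> to it sets the fibre to
  \<open>J\<close>.\<close>

lemma lift_parts:
  assumes A: "p.subspace A" and J: "M1.subspace J" "J \<subseteq> fibre A"
    and D: "M2.subspace D" "D \<subseteq> snd ` A"
  obtains I where "p.subspace I" "I \<subseteq> A" "fibre I = J" "snd ` I = D"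
proof -
  define T where "T = A \<inter> UNIV \<times> D"
  have sT: "p.subspace T" unfolding T_def using A D
    by (intro p.subspace_inter subspace_Times) auto
  have sF: "p.subspace (fibre A \<times> {0})" using subspace_fibre[OF A] by (intro subspace_Times) auto
  have FT: "fibre A \<times> {0} \<subseteq> T" using M2.subspace_0[OF D(1)] by (auto simp: T_def fibre_def)
  have sndT: "snd ` T = D" using D by (force simp: T_def)
  obtain C where C: "p.subspace C" "C \<subseteq> T" "{x + y | x y. x \<in> fibre A \<times> {0} \<and> y \<in> C} = T"
    "fibre A \<times> {0} \<inter> C = {0}"
    by (rule p.subspace_complement[OF sF sT FT])
  define I where "I = {x + y | x y. x \<in> J \<times> {0} \<and> y \<in> C}"
  have sJ: "p.subspace (J \<times> {0})" using J by (intro subspace_Times) auto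
  have sI: "p.subspace I" unfolding I_def by (rule p.subspace_sums[OF sJ C(1)])
  have "I \<subseteq> T" using C(3) J(2) unfolding I_def by blast
  moreover have "snd ` I = D"
  proof
    show "snd ` I \<subseteq> D" using \<open>I \<subseteq> T\<close> sndT by blast
    show "D \<subseteq> snd ` I"
    proof
      fix d assume "d \<in> D"
      then obtain t where "t \<in> T" "snd t = d" using sndT by blast
      then obtain x y where "x \<in> fibre A \<times> {0}" "y \<in> C" "t = x + y" using C(3) by blast
      have "y \<in> I" unfolding I_def
        using p.subspace_0[OF sJ] \<open>y \<in> C\<close> by (intro CollectI exI[of _ 0] exI[of _ y]) simp
      moreover have "snd y = d"
        using \<open>snd t = d\<close> \<open>t = x + y\<close> \<open>x \<in> fibre A \<times> {0}\<close> by auto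
      ultimately show "d \<in> snd ` I" by blast
    qed
  qed
  moreover have "fibre I = J"
  proof
    show "J \<subseteq> fibre I"
    proof
      fix j assume "j \<in> J"
      then show "j \<in> fibre I" unfolding I_def fibre_def
        using p.subspace_0[OF C(1)] by (intro CollectI exI[of _ "(j, 0)"] exI[of _ 0]) simp
    qed
    show "fibre I \<subseteq> J"
    proof
      fix x assume "x \<in> fibre I"
      then obtain j c where jc: "j \<in> J" "c \<in> C" "(x, 0) = (j, 0) + c"
        by (auto simp: fibre_def I_def)
      then have "c = (x - j, 0)" by (simp add: prod_eq_iff)
      \<comment> \<open>The complement meets \<open>fibre A \<times> {0}\<close> only in zero, so it
        contributes nothing to the fibre of \<open>I\<close>.\<close>
      then have "c \<in> fibre A \<times> {0}" using jc(2) C(2) by (auto simp: fibre_def T_def)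
      then have "c = 0" using jc C by blast
      then show "x \<in> J" using jc by simp
    qed
  qed
  ultimately show ?thesis using that sI by (auto simp: T_def)
qed

text \<open>The rank of \<open>A\<close> is the largest dimension of an independent subspace. For
  such a subspace, the inequality between nullity and rank deficit bounds the dimension by the first
  term, and independence of its fibre bounds it by the second. Conversely, an independent space
  whose dimension is the minimum is constructed.\<close>

lemma rank_eq:
  assumes A: "p.subspace A"
  shows "rank A = min (r1 UNIV + r2 (snd ` A)) (r1 (fibre A) + int (M2.dim (snd ` A)))"
proof (rule antisym)
  obtain I where I: "M.indep_space I" "I \<subseteq> A" "rank I = rank A" by (rule M.indep_of_rank[OF A])
  then have sI: "p.subspace I" by (simp add: M.indep_space_def)
  note s = subspace_fibre[OF sI] subspace_snd[OF sI] subspace_fibre[OF A] subspace_snd[OF A]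
  have sub: "fibre I \<subseteq> fibre A" "snd ` I \<subseteq> snd ` A" using I by (auto simp: fibre_def)
  have "r1 (fibre I) \<le> r1 (fibre A)" "r2 (snd ` I) \<le> r2 (snd ` A)"
    "M2.dim (snd ` I) \<le> M2.dim (snd ` A)"
    using M1.R2[OF s(1,3) sub(1)] M2.R2[OF s(2,4) sub(2)] M2.dim_subset[OF sub(2)] by auto
  then show "rank A \<le> min (r1 UNIV + r2 (snd ` A)) (r1 (fibre A) + int (M2.dim (snd ` A)))"
    using I(1)[unfolded M.indep_space_def] I(1)[unfolded indep_space_iff] I(3) dim_eq[OF sI]
    by (simp add: M1.indep_space_def M1.rank_deficit_def M2.nullity_def)
next
  note s = subspace_fibre[OF A] subspace_snd[OF A]
  obtain J where J: "M1.indep_space J" "J \<subseteq> fibre A" "r1 J = r1 (fibre A)"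
    by (rule M1.indep_of_rank[OF s(1)])
  obtain K where K: "M2.indep_space K" "K \<subseteq> snd ` A" "r2 K = r2 (snd ` A)"
    by (rule M2.indep_of_rank[OF s(2)])
  \<comment> \<open>The largest dimension of a subspace \<open>D\<close> of \<open>snd\<close>
    A\<open>of rank\<close>r2 (snd \<open>A)\<close> whose nullity does not exceed the rank deficit
    of \<open>fibre A\<close>. The argument of \<open>nat\<close> is nonnegative, so nothing is
    truncated.\<close>
  define n where
    "n = min (M2.dim (snd ` A)) (nat (r2 (snd ` A) + M1.rank_deficit (fibre A)))"
  have def_nonneg: "0 \<le> M1.rank_deficit (fibre A)"
    using M1.R2[OF s(1) M1.subspace_UNIV] by (simp add: M1.rank_deficit_def)
  have r2: "0 \<le> r2 (snd ` A)" "r2 (snd ` A) \<le> int (M2.dim (snd ` A))" using M2.R1[OF s(2)] by auto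
  have "M2.dim K \<le> n" "n \<le> M2.dim (snd ` A)"
    using K def_nonneg r2 by (auto simp: n_def M2.indep_space_def)
  then obtain D where D: "M2.subspace D" "K \<subseteq> D" "D \<subseteq> snd ` A" "M2.dim D = n"
    using M2.obtain_subspace_of_dim[OF s(2), of K] K by (auto simp: M2.indep_space_def)
  have sK: "M2.subspace K" using K by (simp add: M2.indep_space_def)
  have r2D: "r2 D = r2 (snd ` A)"
    using M2.R2[OF sK D(1,2)] M2.R2[OF D(1) s(2) D(3)] K by simp
  obtain I where I: "p.subspace I" "I \<subseteq> A" "fibre I = J" "snd ` I = D"
    using lift_parts[OF A _ J(2) D(1,3)] J by (auto simp: M1.indep_space_def)
  have "M.indep_space I"
    unfolding indep_space_iff I M2.nullity_def D(4) r2D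
    using I J def_nonneg r2 by (auto simp: n_def M1.rank_deficit_def)
  then have "int (p.dim I) \<le> rank A"
    using M.R2[OF I(1) A I(2)] by (simp add: M.indep_space_def)
  moreover have "int (p.dim I) = r1 (fibre A) + int n"
    using dim_eq[OF I(1)] I J D by (simp add: M1.indep_space_def)
  moreover have "int n =
      min (int (M2.dim (snd ` A))) (r2 (snd ` A) + M1.rank_deficit (fibre A))"
    using r2 def_nonneg by (auto simp: n_def min_def)
  ultimately show "min (r1 UNIV + r2 (snd ` A)) (r1 (fibre A) + int (M2.dim (snd ` A))) \<le> rank A"
    by (auto simp: M1.rank_deficit_def)
qed

section \<open>Cyclicity and flatness of \<open>X \<times> {0}\<close> and
  \<open>UNIV \<times> Y\<close>\<close>

lemma rank_Times_zero:
  assumes X: "M1.subspace X"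
  shows "rank (X \<times> {0}) = r1 X"
proof -
  have "snd ` (X \<times> {0}) = ({0} :: 'b set)" using M1.subspace_0[OF X] by (rule snd_Times)
  moreover have "p.subspace (X \<times> {0})" using X by (intro subspace_Times) auto
  ultimately show ?thesis
    using M1.R2[OF X M1.subspace_UNIV] by (simp add: rank_eq fibre_Times)
qed

lemma rank_UNIV_Times:
  assumes Y: "M2.subspace Y"
  shows "rank (UNIV \<times> Y) = r1 UNIV + r2 Y"
proof -
  have "p.subspace (UNIV \<times> Y)" using Y by (intro subspace_Times) auto
  then show ?thesis
    using M2.R1[OF Y] M2.subspace_0[OF Y] by (simp add: rank_eq fibre_Times snd_Times)
qed

lemma subset_Times_zero: "H \<subseteq> X \<times> {0} \<Longrightarrow> H = fibre H \<times> {0}"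
  by (auto simp: fibre_def)

text \<open>All subspaces of \<open>X \<times> {0}\<close> are of the form
  \<open>F \<times> {0}\<close>, so hyperplanes and their ranks correspond to those in
  \<open>M1\<close>.\<close>

lemma cyclic_Times_zero:
  assumes X: "M1.subspace X"
  shows "M.cyclic (X \<times> {0}) \<longleftrightarrow> M1.cyclic X"
proof
  have sX: "p.subspace (X \<times> {0})" using X by (intro subspace_Times) auto
  have dim: "p.dim (Y \<times> {0}) = M1.dim Y" if "M1.subspace Y" for Y
    using that by (simp add: dim_Times)
  {
    assume c: "M.cyclic (X \<times> {0})"
    show "M1.cyclic X"
      unfolding M1.cyclic_iff_hyperplanes
    proof (intro conjI X allI impI)
      fix H assume H: "M1.subspace H" "H \<subseteq> X" "M1.dim H + 1 = M1.dim X"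
      have "rank (H \<times> {0}) = rank (X \<times> {0})"
        using H X by (intro M.rank_hyperplane_cyclic[OF c] subspace_Times) (auto simp: dim)
      then show "r1 H = r1 X" using H X by (simp add: rank_Times_zero)
    qed
  next
    assume c: "M1.cyclic X"
    show "M.cyclic (X \<times> {0})"
      unfolding M.cyclic_iff_hyperplanes
    proof (intro conjI sX allI impI)
      fix H assume H: "p.subspace H" "H \<subseteq> X \<times> {0}" "p.dim H + 1 = p.dim (X \<times> {0})"
      note sF = subspace_fibre[OF H(1)] and HF = subset_Times_zero[OF H(2)]
      have "p.dim H = M1.dim (fibre H)" using HF dim[OF sF] by simp
      then have "r1 (fibre H) = r1 X"
        using H X sF by (intro M1.rank_hyperplane_cyclic[OF c]) (auto simp: dim fibre_def)
      then show "rank H = rank (X \<times> {0})"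
        using HF sF X by (metis rank_Times_zero)
    qed
  }
qed

text \<open>A proper flat \<open>X\<close> has rank below \<open>r1 UNIV\<close>. Hence a larger
  space of the same rank attains the second term of the minimum, which leaves no room for a nonzero
  projection. For \<open>X = UNIV\<close> flatness depends on \<open>M2\<close> and is covered by
  \<open>flat_UNIV_Times\<close>.\<close>

lemma flat_Times_zero:
  assumes X: "M1.subspace X" and ne: "X \<noteq> UNIV"
  shows "M.flat (X \<times> {0}) \<longleftrightarrow> M1.flat X"
proof
  have sX: "p.subspace (X \<times> {0})" using X by (intro subspace_Times) auto
  {
    assume f: "M.flat (X \<times> {0})"
    show "M1.flat X"
      unfolding M1.flat_def
    proof (intro conjI X allI impI)
      fix B assume B: "M1.subspace B" "r1 B = r1 X" "X \<subseteq> B"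
      have "p.subspace (B \<times> {0})" using B by (intro subspace_Times) auto
      moreover have "rank (B \<times> {0}) = rank (X \<times> {0})" using B X by (simp add: rank_Times_zero)
      ultimately have "B \<times> {0} = X \<times> ({0} :: 'b set)" using f B unfolding M.flat_def by blast
      then show "B = X" by blast
    qed
  next
    assume f: "M1.flat X"
    have lt: "r1 X < r1 UNIV"
      using f ne M1.R2[OF X M1.subspace_UNIV] M1.subspace_UNIV unfolding M1.flat_def
      by (metis order_le_less top_greatest)
    show "M.flat (X \<times> {0})"
      unfolding M.flat_def
    proof (intro conjI sX allI impI)
      fix B assume B: "p.subspace B" "rank B = rank (X \<times> {0})" "X \<times> {0} \<subseteq> B"
      note s = subspace_fibre[OF B(1)] subspace_snd[OF B(1)]
      have XB: "X \<subseteq> fibre B" using B(3) by (auto simp: fibre_def)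
      have "r1 X = min (r1 UNIV + r2 (snd ` B)) (r1 (fibre B) + int (M2.dim (snd ` B)))"
        using B(2) rank_eq[OF B(1)] rank_Times_zero[OF X] by simp
      moreover have "0 \<le> r2 (snd ` B)" using M2.R1[OF s(2)] by simp
      moreover have "r1 X \<le> r1 (fibre B)" by (rule M1.R2[OF X s(1) XB])
      ultimately have eq: "r1 (fibre B) = r1 X" and "M2.dim (snd ` B) = 0" using lt by linarith+
      then have "B \<subseteq> fibre B \<times> {0}" by (fastforce simp: fibre_def)
      moreover have "fibre B = X" using f s XB eq unfolding M1.flat_def by blast
      ultimately show "B = X \<times> {0}" using B(3) by simp
    qed
  }
qed

text \<open>A hyperplane of \<open>UNIV \<times> Y\<close> loses one dimension either in the
  projection, where cyclicity of \<open>Y\<close> applies, or in the fibre, where the positive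
  nullity of \<open>Y\<close> absorbs the loss. The latter fails for \<open>Y = {0}\<close>, a case
  left to \<open>cyclic_Times_zero\<close>.\<close>

lemma cyclic_UNIV_Times:
  assumes Y: "M2.subspace Y" and ne: "Y \<noteq> {0}"
  shows "M.cyclic (UNIV \<times> Y) \<longleftrightarrow> M2.cyclic Y"
proof
  have sY: "p.subspace (UNIV \<times> Y)" using Y by (intro subspace_Times) auto
  have dim: "p.dim (UNIV \<times> D) = M1.dim UNIV + M2.dim D" if "M2.subspace D" for D
    using that by (simp add: dim_Times del: M1.dim_UNIV)
  {
    assume c: "M.cyclic (UNIV \<times> Y)"
    show "M2.cyclic Y"
      unfolding M2.cyclic_iff_hyperplanes
    proof (intro conjI Y allI impI)
      fix H assume H: "M2.subspace H" "H \<subseteq> Y" "M2.dim H + 1 = M2.dim Y"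
      have "rank (UNIV \<times> H) = rank (UNIV \<times> Y)"
        using H Y by (intro M.rank_hyperplane_cyclic[OF c] subspace_Times) (auto simp: dim)
      then show "r2 H = r2 Y" using H Y by (simp add: rank_UNIV_Times)
    qed
  next
    assume c: "M2.cyclic Y"
    show "M.cyclic (UNIV \<times> Y)"
      unfolding M.cyclic_iff_hyperplanes
    proof (intro conjI sY allI impI)
      fix H assume H: "p.subspace H" "H \<subseteq> UNIV \<times> Y" "p.dim H + 1 = p.dim (UNIV \<times> Y)"
      note s = subspace_fibre[OF H(1)] subspace_snd[OF H(1)]
      have HY: "snd ` H \<subseteq> Y" using H(2) by auto
      have d: "M1.dim (fibre H) + M2.dim (snd ` H) + 1 = M1.dim UNIV + M2.dim Y"
        using H(3) Y by (simp add: dim dim_eq[OF H(1)] del: M1.dim_UNIV)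
      have dle: "M1.dim (fibre H) \<le> M1.dim UNIV" "M2.dim (snd ` H) \<le> M2.dim Y"
        using M1.dim_subset[of "fibre H" UNIV] M2.dim_subset[OF HY] by simp_all
      show "rank H = rank (UNIV \<times> Y)"
      proof (cases "M2.dim (snd ` H) = M2.dim Y")
        case True
        then have HY: "snd ` H = Y" using s(2) Y HY by (intro M2.subspace_dim_equal) auto
        \<comment> \<open>The fibre has codimension one, so its rank drops by at most one. As
          \<open>r2 Y + 1 \<le> dim Y\<close>, the second term of the minimum stays at least
          \<open>r1 UNIV + r2 Y\<close>.\<close>
        have "r1 UNIV - 1 \<le> r1 (fibre H)"
          using M1.nullity_mono[OF s(1) M1.subspace_UNIV] d True by (simp add: M1.nullity_def)
        moreover have "r2 Y < int (M2.dim Y)" by (rule M2.cyclic_nonzero_nullity[OF c ne])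
        ultimately show ?thesis
          using Y HY by (simp add: rank_eq[OF H(1)] rank_UNIV_Times)
      next
        case False
        then have "M1.dim (fibre H) = M1.dim UNIV" and d2: "M2.dim (snd ` H) + 1 = M2.dim Y"
          using d dle by linarith+
        then have "fibre H = UNIV" using s by (intro M1.subspace_dim_equal) auto
        then have "H = UNIV \<times> snd ` H" by (rule Times_UNIV_of_fibre[OF H(1)])
        then have "rank H = r1 UNIV + r2 (snd ` H)" using s(2) rank_UNIV_Times by metis
        then show ?thesis
          using M2.rank_hyperplane_cyclic[OF c s(2) HY d2] Y by (simp add: rank_UNIV_Times)
      qed
    qed
  }
qed

text \<open>Every space above \<open>UNIV \<times> Y\<close> has full fibre and is therefore itself
  a product, with rank \<open>r1 UNIV\<close> plus a rank in \<open>M2\<close>.\<close>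

lemma flat_UNIV_Times:
  assumes Y: "M2.subspace Y"
  shows "M.flat (UNIV \<times> Y) \<longleftrightarrow> M2.flat Y"
proof
  have sY: "p.subspace (UNIV \<times> Y)" using Y by (intro subspace_Times) auto
  {
    assume f: "M.flat (UNIV \<times> Y)"
    show "M2.flat Y"
      unfolding M2.flat_def
    proof (intro conjI Y allI impI)
      fix B assume B: "M2.subspace B" "r2 B = r2 Y" "Y \<subseteq> B"
      have "p.subspace (UNIV \<times> B)" using B by (intro subspace_Times) auto
      moreover have "rank (UNIV \<times> B) = rank (UNIV \<times> Y)" using B Y by (simp add: rank_UNIV_Times)
      ultimately have "(UNIV :: 'a set) \<times> B = UNIV \<times> Y" using f B unfolding M.flat_def by blast
      then show "B = Y" by blast
    qed
  next
    assume f: "M2.flat Y"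
    show "M.flat (UNIV \<times> Y)"
      unfolding M.flat_def
    proof (intro conjI sY allI impI)
      fix B assume B: "p.subspace B" "rank B = rank (UNIV \<times> Y)" "UNIV \<times> Y \<subseteq> B"
      note s = subspace_fibre[OF B(1)] subspace_snd[OF B(1)]
      have "fibre B = UNIV" using B(3) M2.subspace_0[OF Y] by (auto simp: fibre_def)
      then have eq: "B = UNIV \<times> snd ` B" by (rule Times_UNIV_of_fibre[OF B(1)])
      then have "rank B = r1 UNIV + r2 (snd ` B)" using s(2) rank_UNIV_Times by metis
      then have "r2 (snd ` B) = r2 Y" using B(2) Y by (simp add: rank_UNIV_Times)
      moreover have "Y \<subseteq> snd ` B" using B(3) by force
      ultimately have "snd ` B = Y" using f s(2) unfolding M2.flat_def by blast
      then show "B = UNIV \<times> Y" using eq by simp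
    qed
  }
qed

section \<open>Classification of the cyclic flats of the free product\<close>

lemma flat_zero_iff_no_loop: "M2.flat {0} \<longleftrightarrow> (\<nexists>L. M2.loop L)"
  unfolding M2.loop_iff_rank_zero M2.flat_def using M2.subspace_0 by auto

lemma cyclic_flat_cases:
  assumes Z: "Z \<in> M.cyclic_flats"
  obtains X where "M1.subspace X" "X \<noteq> UNIV" "Z = X \<times> {0}"
    | Y where "M2.subspace Y" "Y \<noteq> {0}" "Z = UNIV \<times> Y"
    | "Z = UNIV \<times> {0}"
proof -
  have c: "M.cyclic Z" and f: "M.flat Z" using Z by (auto simp: M.cyclic_flats_def)
  have sZ: "p.subspace Z" by (rule M.subspace_cyclic[OF c])
  note s = subspace_fibre[OF sZ] subspace_snd[OF sZ]
  have "snd ` Z = {0} \<or> fibre Z = UNIV"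
  proof (rule ccontr)
    assume "\<not> ?thesis"
    then have ne: "snd ` Z \<noteq> {0}" "fibre Z \<noteq> UNIV" by auto
    show False
    proof (cases "r1 (fibre Z) + int (M2.dim (snd ` Z)) \<le> r1 UNIV + r2 (snd ` Z)")
      case True
      have "{0} \<subset> snd ` Z" using ne M2.subspace_0[OF s(2)] by auto
      then obtain D where D: "M2.subspace D" "D \<subseteq> snd ` Z" "M2.dim D + 1 = M2.dim (snd ` Z)"
        using M2.obtain_hyperplane[OF s(2) M2.subspace_single_0] by metis
      \<comment> \<open>Keeping the fibre and shrinking the projection lowers the second term by
        one. That term is the rank of \<open>Z\<close>, so the hyperplane \<open>H\<close> has
        smaller rank, against cyclicity.\<close>
      obtain H where H: "p.subspace H" "H \<subseteq> Z" "fibre H = fibre Z" "snd ` H = D"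
        by (rule lift_parts[OF sZ s(1) order_refl D(1,2)])
      have "p.dim H + 1 = p.dim Z" using H D by (simp add: dim_eq sZ)
      then have "rank H = rank Z" using H by (intro M.rank_hyperplane_cyclic[OF c])
      then show False using True D H by (simp add: rank_eq sZ)
    next
      case False
      define B :: "('a \<times> 'b) set" where "B = UNIV \<times> snd ` Z"
      have "p.subspace B" unfolding B_def using s by (intro subspace_Times) auto
      \<comment> \<open>Here \<open>rank Z\<close> is the first term, which depends only on the
        projection.\<close>
      moreover have "rank B = rank Z"
        using False s by (simp add: B_def rank_UNIV_Times rank_eq[OF sZ])
      moreover have "Z \<subseteq> B" by (force simp: B_def)
      ultimately have "B = Z" using f unfolding M.flat_def by blast
      then have "fibre Z = UNIV"
        using M2.subspace_0[OF s(2)] fibre_Times[of "snd ` Z" UNIV] by (simp add: B_def)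
      then show False using ne by blast
    qed
  qed
  then show ?thesis
  proof
    assume z: "snd ` Z = {0}"
    then have "Z \<subseteq> UNIV \<times> {0}" by force
    then have "Z = fibre Z \<times> {0}" by (rule subset_Times_zero)
    then show ?thesis using that s(1) by metis
  next
    assume "fibre Z = UNIV"
    then have "Z = UNIV \<times> snd ` Z" by (rule Times_UNIV_of_fibre[OF sZ])
    then show ?thesis using that s(2) by metis
  qed
qed

lemma Times_zero_cyclic_flat_iff:
  assumes "M1.subspace X" "X \<noteq> UNIV"
  shows "X \<times> {0} \<in> M.cyclic_flats \<longleftrightarrow> X \<in> M1.cyclic_flats"
  using assms
  by (simp add: M.cyclic_flats_def M1.cyclic_flats_def cyclic_Times_zero flat_Times_zero)

lemma UNIV_Times_cyclic_flat_iff: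
  assumes "M2.subspace Y" "Y \<noteq> {0}"
  shows "UNIV \<times> Y \<in> M.cyclic_flats \<longleftrightarrow> Y \<in> M2.cyclic_flats"
  using assms
  by (simp add: M.cyclic_flats_def M2.cyclic_flats_def cyclic_UNIV_Times flat_UNIV_Times)

text \<open>The one space belonging to both families: read as \<open>X \<times> {0}\<close> it is
  cyclic iff \<open>M1\<close> has no coloops, and read as \<open>UNIV \<times> Y\<close> it is flat
  iff \<open>M2\<close> has no loops.\<close>

lemma UNIV_Times_zero_cyclic_flat_iff:
  "UNIV \<times> {0} \<in> M.cyclic_flats \<longleftrightarrow> (\<nexists>H. M1.coloop H) \<and> (\<nexists>L. M2.loop L)"
  by (simp add: M.cyclic_flats_def cyclic_Times_zero flat_UNIV_Times M1.coloop_iff_not_cyclic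
      flat_zero_iff_no_loop)

end

theorem theorem3p13:
  fixes scale1 :: "'f::{field,finite} \<Rightarrow> 'a::ab_group_add \<Rightarrow> 'a" and r1 :: "'a set \<Rightarrow> int"
    and scale2 :: "'f \<Rightarrow> 'b::ab_group_add \<Rightarrow> 'b" and r2 :: "'b set \<Rightarrow> int"
  assumes "q_matroid scale1 r1" and "q_matroid scale2 r2"
  shows "q_matroid.cyclic_flats (module_prod.scale scale1 scale2)
           (free_product scale1 r1 scale2 r2) =
    (let \<Z>1 = q_matroid.cyclic_flats scale1 r1;
         \<Z>2 = q_matroid.cyclic_flats scale2 r2;
         \<Z> = {Z \<times> {0} | Z. Z \<in> \<Z>1 - {UNIV}} \<union> {UNIV \<times> Z | Z. Z \<in> \<Z>2 - {{0}}}
     in if (\<nexists>H. q_matroid.coloop scale1 r1 H) \<and> (\<nexists>L. q_matroid.loop scale2 r2 L)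
        then \<Z> \<union> {UNIV \<times> {0}} else \<Z>)"
proof -
  obtain B1 where B1: "finite_dimensional_vector_space scale1 B1"
    by (rule q_matroid.obtain_basis[OF assms(1)])
  obtain B2 where B2: "finite_dimensional_vector_space scale2 B2"
    by (rule q_matroid.obtain_basis[OF assms(2)])
  interpret q_matroid_pair scale1 r1 B1 scale2 r2 B2
    using assms B1 B2 by (simp add: q_matroid_pair_def finite_dimensional_q_matroid_def)
  define \<Z> where "\<Z> = {Z \<times> {0} | Z. Z \<in> M1.cyclic_flats - {UNIV}} \<union>
    {UNIV \<times> Z | Z. Z \<in> M2.cyclic_flats - {{0}}}"
  have sub: "\<Z> \<subseteq> M.cyclic_flats"
    unfolding \<Z>_def
    using Times_zero_cyclic_flat_iff UNIV_Times_cyclic_flat_iff M1.subspace_cyclic_flats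
      M2.subspace_cyclic_flats by blast
  have sup: "Z \<in> \<Z> \<or> Z = UNIV \<times> {0}" if "Z \<in> M.cyclic_flats" for Z
    using that
  proof (cases rule: cyclic_flat_cases)
    case (1 X)
    then show ?thesis using that Times_zero_cyclic_flat_iff[of X] by (auto simp: \<Z>_def)
  next
    case (2 Y)
    then show ?thesis using that UNIV_Times_cyclic_flat_iff[of Y] by (auto simp: \<Z>_def)
  qed simp
  have "M.cyclic_flats =
    (if (\<nexists>H. M1.coloop H) \<and> (\<nexists>L. M2.loop L) then \<Z> \<union> {UNIV \<times> {0}} else \<Z>)"
    \<comment> \<open>With the condition rewritten as membership of
      \<open>UNIV \<times> {0}\<close>, the two inclusions settle both cases.\<close>
    unfolding UNIV_Times_zero_cyclic_flat_iff[symmetric] using sub sup by auto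
  then show ?thesis unfolding Let_def \<Z>_def .
qed

end
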